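(* Let $1\le s\le n$ and let $P\subseteq\mathcal P(n,s)$ be an $(n,s)$-Vandermonde covering. Then $$|P|\ge\sum_{i=0}^{\lfloor s/2\rfloor}B_i,$$ where $B_0:=0$, $B_1:=1$ and $$B_i:=\left\lceil 2\,\frac{|\mathcal P(n-s+1,i)|-i\,B_{i-1}-B_{i-2}}{i^2+i}\right\rceil$$ for all $i\in\{2,\dots,\lfloor s/2\rfloor\}$.
   Context: A univariate real polynomial is hyperbolic if all its roots are real; $\mathcal H$ is the set of monic hyperbolic polynomials of degree $n$ in $\mathbb R[T]$. For $F=T^n+F_1T^{n-1}+\dots+F_n\in\mathcal H$, the hyperbolic slice is $\mathcal H_s(F)=\{T^n+H_1T^{n-1}+\dots+H_n\in\mathcal H : H_i=F_i \text{ for } 1\le i\le s\}$. $\mathcal P(m,r)$ is the set of partitions of $m$ into exactly $r$ positive parts. For $G\in\mathcal H$, $p(G)$ is the partition of $n$ formed by the multiplicities of the distinct roots of $G$. For partitions $p,q$ of $n$, $p\le q$ means that $p$ can be obtained from $q$ by summing some of the parts of $q$ and reordering (i.e. by grouping the parts of $q$ and replacing each group by its sum). A set $P\subseteq\mathcal P(n,s)$ is an $(n,s)$-Vandermonde covering if for every hyperbolic slice $\mathcal H_s(F)$, $F\in\mathcal H$, there are $q\in P$ and $G\in\mathcal H_s(F)$ with $q\ge p(G)$. *)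

theory Defs
  imports Complex_Main "HOL-Library.Multiset" "HOL-Computational_Algebra.Polynomial"
begin

definition hyperbolic :: "real poly \<Rightarrow> bool" where
  "hyperbolic p \<longleftrightarrow> (\<forall>z::complex. poly (map_poly of_real p) z = 0 \<longrightarrow> z \<in> \<real>)"

definition hyperbolic_polys :: "nat \<Rightarrow> real poly set" where
  "hyperbolic_polys n = {F. degree F = n \<and> lead_coeff F = 1 \<and> hyperbolic F}"

(* The coefficient written F_i in F = T^n + F_1 T^(n-1) + ... + F_n is coeff F (n - i). *)
definition hyperbolic_slice :: "nat \<Rightarrow> nat \<Rightarrow> real poly \<Rightarrow> real poly set" where
  "hyperbolic_slice n s F =
     {H \<in> hyperbolic_polys n. \<forall>i\<in>{1..s}. coeff H (n - i) = coeff F (n - i)}"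

definition partitions :: "nat \<Rightarrow> nat \<Rightarrow> nat multiset set" where
  "partitions m r = {p. 0 \<notin># p \<and> sum_mset p = m \<and> size p = r}"

definition root_partition :: "real poly \<Rightarrow> nat multiset" where
  "root_partition G = {#order x G. x \<in># mset_set {x. poly G x = 0}#}"

(* M is the multiset of groups into which the parts of q are distributed. *)
definition coarser :: "nat multiset \<Rightarrow> nat multiset \<Rightarrow> bool" where
  "coarser p q \<longleftrightarrow>
     (\<exists>M. {#} \<notin># M \<and> sum_mset M = q \<and> image_mset sum_mset M = p)"

definition vandermonde_covering :: "nat \<Rightarrow> nat \<Rightarrow> nat multiset set \<Rightarrow> bool" where
  "vandermonde_covering n s P \<longleftrightarrow>
     P \<subseteq> partitions n s \<and>
     (\<forall>F \<in> hyperbolic_polys n. \<exists>q \<in> P. \<exists>G \<in> hyperbolic_slice n s F. coarser (root_partition G) q)"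

(* Integer valued, since the expression under the ceiling can be negative.
   The bound for (n,s)-coverings uses m = n - s + 1. *)
fun B_seq :: "nat \<Rightarrow> nat \<Rightarrow> int" where
  "B_seq m i =
     (if i = 0 then 0
      else if i = 1 then 1
      else \<lceil>2 * ((real (card (partitions m i)) - real i * of_int (B_seq m (i - 1)) - of_int (B_seq m (i - 2)))
                / ((real i)\<^sup>2 + real i))\<rceil>)"

(* The defining equation loops as a rewrite rule. *)
declare B_seq.simps [simp del]

end

theory Submission
  imports Defs "HOL-Computational_Algebra.Polynomial_FPS"
    "HOL-Computational_Algebra.Fundamental_Theorem_Algebra"
begin

text \<open>
  The bound comes from slices that consist of a single polynomial. Let \<open>F\<close> have \<open>s - 1\<close>
  distinct roots, such that the second, fourth, sixth, and so on, root from the left is simple. Then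
  the slice of \<open>F\<close> is \<open>{F}\<close> (\<open>grid_slice_rigid\<close>). Indeed, by Newton's identities the sorted
  roots \<open>y\<^sub>j\<close> of another member satisfy \<open>\<Sum>\<^sub>j g y\<^sub>j = \<Sum>\<^sub>j g x\<^sub>j\<close> for all polynomials
  \<open>g\<close> of degree at most \<open>s\<close>. Within a block of equal \<open>x\<^sub>j\<close> the sign of \<open>y\<^sub>j - x\<^sub>j\<close> can
  only go from minus to plus, and in a block of one element it does not change at all. Along the
  whole list there are therefore at most \<open>s - 1\<close> sign changes, and some nonzero polynomial \<open>h\<close>
  of degree \<open>s - 1\<close> never has, between \<open>x\<^sub>j\<close> and \<open>y\<^sub>j\<close>, the sign opposite to that of
  \<open>y\<^sub>j - x\<^sub>j\<close>. For an antiderivative \<open>g\<close> of \<open>h\<close> all differences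
  \<open>g y\<^sub>j - g x\<^sub>j\<close> are then nonnegative with sum zero, which forces \<open>y\<^sub>j = x\<^sub>j\<close>.

  Put \<open>m = n - s + 1\<close> and let \<open>p\<close> be a partition of \<open>m\<close> into \<open>i \<le> s div 2\<close> parts. Increasing
  every part by one and adding \<open>s - 1 - i\<close> ones gives a partition of \<open>n\<close> into \<open>s - 1\<close> parts, and
  putting the increased parts at the first, third, fifth, and so on, root makes it the root partition of
  such an \<open>F\<close>. A covering \<open>P\<close> therefore contains a \<open>q\<close> coarsened by it; as \<open>q\<close> has just one part
  more, the coarsening merges exactly two parts of \<open>q\<close> (\<open>covering_merges\<close>). Call a part large if
  it is at least 2. The result has \<open>i\<close> large parts, so \<open>q\<close> has \<open>i + 1\<close> of them and two large parts
  were merged (at most \<open>(i + 1) choose 2\<close> ways), or \<open>i\<close> and one of them absorbed a 1 (at most \<open>i\<close>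
  ways), or \<open>i - 1\<close> and two ones were merged (one way). If \<open>N r\<close> counts the members of \<open>P\<close> with
  \<open>r\<close> large parts, this means

    \<open>card (partitions m i) \<le> (Suc i choose 2) * N (Suc i) + i * N i + N (i - 1)\<close>

  (\<open>card_partitions_le\<close>). With \<open>B_seq m i\<close> in place of \<open>N (Suc i)\<close> this inequality becomes an
  equality, up to the rounding in the definition of \<open>B_seq\<close>. Written in terms of partial
  sums, the inequalities have nonnegative coefficients, so the partial sums of \<open>N\<close> dominate those
  of \<open>B_seq m\<close> (\<open>sum_B_seq_le\<close>).
\<close>

section \<open>Coefficients determine power sums\<close>

lemma reflect_poly_prod_linear:
  fixes xs :: "real list"
  shows "reflect_poly (\<Prod>x\<leftarrow>xs. [:-x, 1:]) = (\<Prod>x\<leftarrow>xs. [:1, -x:])"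
proof (induction xs)
  case (Cons x xs)
  have "reflect_poly [:-x, 1:] = [:1, -x:]"
    by (simp add: reflect_poly_pCons' monom_altdef)
  with Cons show ?case by (simp add: reflect_poly_mult del: mult_pCons_left)
qed simp

lemma coeff_0_prod_linear: "coeff (\<Prod>x\<leftarrow>xs. [:1, -x:]) 0 = (1 :: real)"
  by (induction xs) (auto simp: coeff_mult_0 coeff_mult)

text \<open>
  Newton's identities as one equation of power series: the logarithmic derivative of
  \<open>1 - x X\<close> is \<open>- x / (1 - x X)\<close>, a geometric series.
\<close>
lemma fps_deriv_prod_linear:
  fixes xs :: "real list"
  shows "fps_deriv (fps_of_poly (\<Prod>x\<leftarrow>xs. [:1, -x:])) =
    - (fps_of_poly (\<Prod>x\<leftarrow>xs. [:1, -x:]) * Abs_fps (\<lambda>k. \<Sum>x\<leftarrow>xs. x ^ Suc k))"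
proof (induction xs)
  case Nil
  then show ?case by (simp add: fps_eq_iff)
next
  case (Cons x xs)
  define E where "E = fps_of_poly (\<Prod>x\<leftarrow>xs. [:1, -x:])"
  define Q where "Q = Abs_fps (\<lambda>k. \<Sum>x\<leftarrow>xs. x ^ Suc k)"
  define G where "G = Abs_fps (\<lambda>k. x ^ Suc k)"
  define l where "l = (1 - fps_const x * fps_X :: real fps)"
  have l: "fps_of_poly [:1, -x:] = l"
    by (simp add: l_def fps_of_poly_pCons fps_const_neg[symmetric] del: fps_const_neg)
  have lG: "l * G = fps_const x"
  proof (rule fps_ext)
    fix k
    have "fps_nth (l * G) k = fps_nth G k - x * fps_nth (fps_X * G) k"
      by (simp add: l_def algebra_simps)
    also have "\<dots> = fps_nth (fps_const x) k"
      by (cases k) (simp_all add: G_def)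
    finally show "fps_nth (l * G) k = fps_nth (fps_const x) k" .
  qed
  have dl: "fps_deriv l = - fps_const x" by (simp add: l_def)
  have IH: "fps_deriv E = - (E * Q)" using Cons by (simp add: E_def Q_def)
  have "Abs_fps (\<lambda>k. \<Sum>y\<leftarrow>x#xs. y ^ Suc k) = G + Q"
    by (simp add: fps_eq_iff G_def Q_def)
  moreover have "fps_of_poly (\<Prod>y\<leftarrow>x#xs. [:1, -y:]) = l * E"
    by (simp add: fps_of_poly_mult l E_def del: mult_pCons_left)
  moreover have "fps_deriv (l * E) = - (l * E * (G + Q))"
  proof -
    have "fps_deriv (l * E) = l * fps_deriv E + fps_deriv l * E" by simp
    also have "\<dots> = - (l * E * Q) - (l * G) * E"
      by (simp only: IH dl lG) algebra
    also have "\<dots> = - (l * E * (G + Q))" by (simp add: algebra_simps)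
    finally show ?thesis .
  qed
  ultimately show ?case by simp
qed

text \<open>
  The reversed polynomial has constant coefficient 1, so each of Newton's identities can be solved
  for the power sum of highest order in terms of lower ones and of coefficients.
\<close>
lemma power_sums_determined:
  fixes xs ys :: "real list"
  assumes len: "length xs = length ys"
    and coeffs: "\<And>k. k \<le> s \<Longrightarrow> coeff (\<Prod>x\<leftarrow>xs. [:1, -x:]) k = coeff (\<Prod>y\<leftarrow>ys. [:1, -y:]) k"
    and "k \<le> s"
  shows "(\<Sum>x\<leftarrow>xs. x ^ k) = (\<Sum>y\<leftarrow>ys. y ^ k)"
  using \<open>k \<le> s\<close>
proof (induction k rule: less_induct)
  case (less k)
  show ?case
  proof (cases k)
    case 0
    then show ?thesis using len by (simp add: sum_list_triv)
  next
    case (Suc m)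
    have newton: "real (Suc m) * coeff (\<Prod>z\<leftarrow>zs. [:1, -z:]) (Suc m) =
        - ((\<Sum>z\<leftarrow>zs. z ^ Suc m) +
           (\<Sum>i = Suc 0..m. coeff (\<Prod>z\<leftarrow>zs. [:1, -z:]) i * (\<Sum>z\<leftarrow>zs. z ^ Suc (m - i))))"
      for zs :: "real list"
    proof -
      have "real (Suc m) * coeff (\<Prod>z\<leftarrow>zs. [:1, -z:]) (Suc m) =
        - (\<Sum>i = 0..m. coeff (\<Prod>z\<leftarrow>zs. [:1, -z:]) i * (\<Sum>z\<leftarrow>zs. z ^ Suc (m - i)))"
        using arg_cong[OF fps_deriv_prod_linear[of zs], of "\<lambda>f. fps_nth f m"]
        by (simp add: fps_mult_nth)
      then show ?thesis
        by (simp add: sum.atLeast_Suc_atMost coeff_0_prod_linear)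
    qed
    have "(\<Sum>i = Suc 0..m. coeff (\<Prod>z\<leftarrow>xs. [:1, -z:]) i * (\<Sum>z\<leftarrow>xs. z ^ Suc (m - i))) =
          (\<Sum>i = Suc 0..m. coeff (\<Prod>z\<leftarrow>ys. [:1, -z:]) i * (\<Sum>z\<leftarrow>ys. z ^ Suc (m - i)))"
    proof (rule sum.cong[OF refl])
      fix i assume i: "i \<in> {Suc 0..m}"
      have "coeff (\<Prod>z\<leftarrow>xs. [:1, -z:]) i = coeff (\<Prod>z\<leftarrow>ys. [:1, -z:]) i"
        using coeffs[of i] i less.prems Suc by simp
      moreover have "(\<Sum>z\<leftarrow>xs. z ^ Suc (m - i)) = (\<Sum>z\<leftarrow>ys. z ^ Suc (m - i))"
        using less.IH[of "Suc (m - i)"] i less.prems Suc by fastforce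
      ultimately show "coeff (\<Prod>z\<leftarrow>xs. [:1, -z:]) i * (\<Sum>z\<leftarrow>xs. z ^ Suc (m - i)) =
        coeff (\<Prod>z\<leftarrow>ys. [:1, -z:]) i * (\<Sum>z\<leftarrow>ys. z ^ Suc (m - i))" by simp
    qed
    then show ?thesis
      using newton[of xs] newton[of ys] coeffs[of "Suc m"] less.prems Suc by simp
  qed
qed

lemma poly_sums_determined:
  fixes xs ys :: "real list"
  assumes "length xs = length ys"
    and "\<And>k. k \<le> s \<Longrightarrow> coeff (\<Prod>x\<leftarrow>xs. [:1, -x:]) k = coeff (\<Prod>y\<leftarrow>ys. [:1, -y:]) k"
    and "degree g \<le> s"
  shows "(\<Sum>x\<leftarrow>xs. poly g x) = (\<Sum>y\<leftarrow>ys. poly g y)"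
proof -
  have "(\<Sum>z\<leftarrow>zs. poly g z) = (\<Sum>i\<le>degree g. coeff g i * (\<Sum>z\<leftarrow>zs. z ^ i))" for zs :: "real list"
    by (induction zs) (simp_all add: poly_altdef sum.distrib algebra_simps)
  moreover have "(\<Sum>x\<leftarrow>xs. x ^ i) = (\<Sum>y\<leftarrow>ys. y ^ i)" if "i \<le> degree g" for i
    by (rule power_sums_determined[OF assms(1,2)]) (use assms(3) that in auto)
  ultimately show ?thesis by simp
qed

section \<open>Hyperbolic polynomials as products of linear factors\<close>

lemma map_poly_of_real_mult:
  "map_poly of_real (p * q) = (map_poly of_real p * map_poly of_real q :: complex poly)"
  by (rule poly_eqI) (simp add: coeff_map_poly coeff_mult)

lemma poly_map_poly_of_real:
  "poly (map_poly of_real p) (of_real x) = (of_real (poly p x) :: complex)"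
  by (simp add: poly_altdef degree_map_poly coeff_map_poly)

lemma hyperbolic_prod_linear: "hyperbolic (\<Prod>x\<leftarrow>xs. [:-x, 1:])"
proof -
  have "map_poly complex_of_real (\<Prod>x\<leftarrow>xs. [:-x, 1:]) = (\<Prod>x\<leftarrow>xs. [:- complex_of_real x, 1:])"
    by (induction xs) (simp_all add: map_poly_of_real_mult map_poly_pCons del: mult_pCons_left)
  moreover have "poly (\<Prod>x\<leftarrow>xs. [:- complex_of_real x, 1:]) z = (\<Prod>x\<leftarrow>xs. z - complex_of_real x)" for z
    by (induction xs) (simp_all del: mult_pCons_left)
  ultimately show ?thesis
    by (auto simp: hyperbolic_def prod_list_zero_iff)
qed

lemma hyperbolic_splits:
  assumes "F \<in> hyperbolic_polys n"
  shows "\<exists>ys. length ys = n \<and> F = (\<Prod>y\<leftarrow>ys. [:-y, 1:])"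
  using assms
proof (induction n arbitrary: F)
  case 0
  then have "F = 1"
    by (auto simp: hyperbolic_polys_def elim: degree_eq_zeroE)
  then show ?case by simp
next
  case (Suc n)
  let ?F = "map_poly complex_of_real F"
  have F: "degree F = Suc n" "lead_coeff F = 1" "hyperbolic F"
    using Suc.prems by (auto simp: hyperbolic_polys_def)
  have "degree ?F = Suc n" using F(1) by (simp add: degree_map_poly)
  then obtain z where z: "poly ?F z = 0"
    using fundamental_theorem_of_algebra[of ?F] by (auto simp: constant_degree)
  then obtain r where r: "z = complex_of_real r"
    using F(3) by (auto simp: hyperbolic_def elim: Reals_cases)
  have "poly F r = 0" using z r by (simp add: poly_map_poly_of_real)
  then obtain G where G: "F = [:-r, 1:] * G" by (auto simp: poly_eq_0_iff_dvd)
  have "G \<noteq> 0" using F G by auto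
  have lG: "lead_coeff G = 1"
    using F(2) unfolding G lead_coeff_mult by simp
  have dG: "degree G = n"
    using F(1) \<open>G \<noteq> 0\<close> unfolding G by (subst (asm) degree_mult_eq) auto
  have "?F = map_poly complex_of_real [:-r, 1:] * map_poly complex_of_real G"
    unfolding G by (rule map_poly_of_real_mult)
  then have "hyperbolic G" using F(3) by (auto simp: hyperbolic_def)
  then obtain ys where "length ys = n" "G = (\<Prod>y\<leftarrow>ys. [:-y, 1:])"
    using Suc.IH[of G] lG dG by (auto simp: hyperbolic_polys_def)
  then show ?case using G by (intro exI[of _ "r # ys"]) simp
qed

lemma degree_monic_prod_linear:
  "degree (\<Prod>x\<leftarrow>xs. [:-x, 1:]) = length xs \<and> coeff (\<Prod>x\<leftarrow>xs. [:-x, 1:]) (length xs) = (1 :: real)"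
proof (induction xs)
  case (Cons x xs)
  let ?F = "\<Prod>x\<leftarrow>xs. [:-x, 1:]"
  have "?F \<noteq> 0" using Cons by (metis coeff_0 zero_neq_one)
  then have "degree ([:-x, 1:] * ?F) = Suc (length xs)"
    using Cons by (subst degree_mult_eq) simp_all
  moreover have "coeff ([:-x, 1:] * ?F) (Suc (length xs)) = 1"
    using Cons lead_coeff_mult[of "[:-x, 1:]" ?F] calculation by simp
  ultimately show ?case by (simp del: mult_pCons_left)
qed simp

lemma prod_linear_in_hyperbolic_polys:
  "(\<Prod>x\<leftarrow>xs. [:-x, 1:]) \<in> hyperbolic_polys (length xs)"
  by (simp add: hyperbolic_polys_def hyperbolic_prod_linear degree_monic_prod_linear)

lemma hyperbolic_splits_sorted:
  assumes "F \<in> hyperbolic_polys n"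
  obtains ys where "sorted ys" "length ys = n" "F = (\<Prod>y\<leftarrow>ys. [:-y, 1:])"
proof -
  obtain ys where ys: "length ys = n" "F = (\<Prod>y\<leftarrow>ys. [:-y, 1:])"
    using hyperbolic_splits[OF assms] by blast
  have "(\<Prod>y\<leftarrow>sort ys. [:-y, 1:]) = (\<Prod>y\<leftarrow>ys. [:-y, 1:])"
    by (simp flip: prod_mset_prod_list)
  then show ?thesis using ys by (intro that[of "sort ys"]) auto
qed

text \<open>
  In the reversed polynomial the coefficients fixed by a slice are those of lowest degree, whatever
  the number of roots.
\<close>
lemma reflected_coeffs_eq_if_slice:
  assumes "length xs = n" "length ys = n"
    and "(\<Prod>y\<leftarrow>ys. [:-y, 1:]) \<in> hyperbolic_slice n s (\<Prod>x\<leftarrow>xs. [:-x, 1:])" and "k \<le> s"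
  shows "coeff (\<Prod>x\<leftarrow>xs. [:1, -x:]) k = coeff (\<Prod>y\<leftarrow>ys. [:1, -y:]) k"
proof (cases "k = 0")
  case False
  then show ?thesis
    using assms
    by (auto simp: reflect_poly_prod_linear[symmetric] coeff_reflect_poly degree_monic_prod_linear
        hyperbolic_slice_def)
qed (simp add: coeff_0_prod_linear)

section \<open>Root lists determined by few power sums\<close>

lemma poly_antiderivative:
  fixes h :: "real poly"
  obtains g where "pderiv g = h" "degree g \<le> Suc (degree h)"
proof
  let ?g = "\<Sum>k\<le>degree h. monom (coeff h k / real (Suc k)) (Suc k)"
  have "pderiv ?g = (\<Sum>k\<le>degree h. monom (coeff h k) k)"
    by (simp add: higher_pderiv_sum[where n = 1, simplified] pderiv_monom)
  then show "pderiv ?g = h" by (simp add: poly_as_sum_of_monoms)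
  show "degree ?g \<le> Suc (degree h)"
    by (intro degree_sum_le) (auto intro: order_trans[OF degree_monom_le])
qed

text \<open>
  Equality at the ends would make the monotone function \<open>g\<close> constant on the whole interval, hence a
  constant polynomial.
\<close>
lemma poly_strict_increase:
  fixes g :: "real poly"
  assumes "a < b" and nz: "pderiv g \<noteq> 0"
    and nonneg: "\<And>t. a < t \<Longrightarrow> t < b \<Longrightarrow> 0 \<le> poly (pderiv g) t"
  shows "poly g a < poly g b"
proof -
  have mono: "poly g u \<le> poly g v" if "a \<le> u" "u \<le> v" "v \<le> b" for u v
  proof (cases "u = v")
    case False
    with that have "u < v" by simp
    then obtain t where "u < t" "t < v" "poly g v - poly g u = (v - u) * poly (pderiv g) t"
      using poly_MVT by blast
    moreover have "0 \<le> poly (pderiv g) t"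
      using nonneg that \<open>u < t\<close> \<open>t < v\<close> by simp
    ultimately show ?thesis
      using \<open>u < v\<close> by (metis diff_ge_0_iff_ge less_imp_le mult_nonneg_nonneg)
  qed simp
  have "poly g a \<noteq> poly g b"
  proof
    assume eq: "poly g a = poly g b"
    have "{a..b} \<subseteq> {t. poly (g - [:poly g a:]) t = 0}"
      using mono[of a] mono[of _ b] eq by (auto intro: order_antisym)
    moreover have "infinite {a..b}" using \<open>a < b\<close> by (simp add: infinite_Icc)
    ultimately have "infinite {t. poly (g - [:poly g a:]) t = 0}"
      using finite_subset by blast
    then have "g - [:poly g a:] = 0" using poly_roots_finite by blast
    then have "g = [:poly g a:]" by simp
    then have "pderiv g = pderiv [:poly g a:]" by (rule arg_cong)
    with nz show False by (simp add: pderiv_pCons)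
  qed
  with mono[of a b] \<open>a < b\<close> show ?thesis by simp
qed

text \<open>
  For an antiderivative \<open>g\<close> of \<open>h\<close> every difference \<open>g (ys ! j) - g (xs ! j)\<close> is nonnegative, and
  positive unless both entries agree; but the differences add up to zero.
\<close>
lemma eq_if_sign_aligned:
  fixes xs ys :: "real list"
  assumes len: "length xs = length ys"
    and sums: "\<And>g. degree g \<le> s \<Longrightarrow> (\<Sum>x\<leftarrow>xs. poly g x) = (\<Sum>y\<leftarrow>ys. poly g y)"
    and h: "h \<noteq> 0" "degree h < s"
    and pos: "\<And>j t. j < length xs \<Longrightarrow> xs ! j < t \<Longrightarrow> t < ys ! j \<Longrightarrow> 0 \<le> poly h t"
    and neg: "\<And>j t. j < length xs \<Longrightarrow> ys ! j < t \<Longrightarrow> t < xs ! j \<Longrightarrow> poly h t \<le> 0"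
  shows "xs = ys"
proof -
  obtain g where g: "pderiv g = h" "degree g \<le> Suc (degree h)"
    by (rule poly_antiderivative)
  have up: "poly g (xs ! j) < poly g (ys ! j)" if "j < length xs" "xs ! j \<noteq> ys ! j" for j
  proof (cases "xs ! j < ys ! j")
    case True
    then show ?thesis using poly_strict_increase[of "xs ! j" "ys ! j" g] pos that g h by auto
  next
    case False
    then have "ys ! j < xs ! j" using that by simp
    then have "poly (-g) (ys ! j) < poly (-g) (xs ! j)"
      using neg that g h by (intro poly_strict_increase) (auto simp: pderiv_minus)
    then show ?thesis by simp
  qed
  have "(\<Sum>j<length xs. poly g (ys ! j) - poly g (xs ! j)) = 0"
    using sums[of g] g h len
    by (simp add: sum_list_sum_nth sum_subtractf atLeast0LessThan)
  moreover have "\<forall>j\<in>{..<length xs}. 0 \<le> poly g (ys ! j) - poly g (xs ! j)"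
    using up by (metis diff_ge_0_iff_ge lessThan_iff less_eq_real_def)
  ultimately have "\<forall>j\<in>{..<length xs}. poly g (ys ! j) - poly g (xs ! j) = 0"
    using sum_nonneg_eq_0_iff[of "{..<length xs}" "\<lambda>j. poly g (ys ! j) - poly g (xs ! j)"] by auto
  then show ?thesis
    using up len by (intro nth_equalityI) force+
qed

text \<open>
  The sign is governed by the number \<open>r\<close> of breakpoints to the left of \<open>t\<close>. As the breakpoints are
  sorted, \<open>t\<close> lies between two neighbouring ones, and this is all that the sign argument below has
  to look at.
\<close>
lemma sgn_prod_of_sorted:
  fixes c :: "nat \<Rightarrow> real"
  assumes "\<And>k. Suc k < L \<Longrightarrow> c k \<le> c (Suc k)" and "t \<notin> c ` {..<L}"
  shows "\<exists>r\<le>L. (0 < r \<longrightarrow> c (r - 1) < t) \<and> (r < L \<longrightarrow> t < c r) \<and> sgn (\<Prod>k<L. c k - t) = (-1) ^ r"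
  using assms
proof (induction L)
  case (Suc L)
  have "\<exists>r\<le>L. (0 < r \<longrightarrow> c (r - 1) < t) \<and> (r < L \<longrightarrow> t < c r) \<and> sgn (\<Prod>k<L. c k - t) = (-1) ^ r"
    by (rule Suc.IH) (use Suc.prems in auto)
  then obtain r where r: "r \<le> L" "0 < r \<longrightarrow> c (r - 1) < t" "r < L \<longrightarrow> t < c r"
      "sgn (\<Prod>k<L. c k - t) = (-1) ^ r"
    by blast
  have "c L \<noteq> t" using Suc.prems(2) by auto
  show ?case
  proof (cases "t < c L")
    case True
    then show ?thesis using r by (intro exI[of _ r]) (auto simp: sgn_mult less_Suc_eq)
  next
    case False
    have "c r \<le> c L"
      using \<open>r \<le> L\<close>
    proof (induction rule: inc_induct)
      case (step k)
      then show ?case using Suc.prems(1)[of k] by linarith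
    qed simp
    then have "r = L" using r(1,3) False by fastforce
    then show ?thesis using r False \<open>c L \<noteq> t\<close>
      by (intro exI[of _ "Suc L"]) (auto simp: sgn_mult)
  qed
qed simp

text \<open>
  For odd \<open>k\<close>, the list \<open>xs\<close> can take the value \<open>k\<close> at the index \<open>w k\<close> only. The polynomial
  \<open>h\<close> must be nonpositive to the left of an even point \<open>k\<close> and nonnegative to its right as far as
  entries of \<open>ys\<close> have moved away from \<open>k\<close>, so it changes sign at \<open>k\<close>. Between two even points it
  has to change back once, and the new place \<open>ys ! w k\<close> of the simple entry \<open>k\<close> is a correct
  position: indices below \<open>w k\<close> have moved at most that far to the right, indices above \<open>w k\<close> at
  most that far to the left. If this place lies beyond one of the even points \<open>k - 1\<close> and
  \<open>k + 1\<close>, no entry of \<open>ys\<close> moves away from that point in the direction of \<open>k\<close>, and the change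
  back is put on that point, where the two sign changes cancel.
\<close>
lemma alternating_simple_rigid:
  fixes xs ys :: "real list"
  assumes sorted: "sorted xs" "sorted ys" and len: "length xs = length ys"
    and xs: "set xs \<subseteq> real ` {..<L}"
    and w: "\<And>k. odd k \<Longrightarrow> k < L \<Longrightarrow> w k < length xs"
      "\<And>k j. odd k \<Longrightarrow> k < L \<Longrightarrow> j < length xs \<Longrightarrow> xs ! j \<le> real k \<Longrightarrow> j \<le> w k"
      "\<And>k j. odd k \<Longrightarrow> k < L \<Longrightarrow> j < length xs \<Longrightarrow> real k \<le> xs ! j \<Longrightarrow> w k \<le> j"
    and sums: "\<And>g. degree g \<le> Suc L \<Longrightarrow> (\<Sum>x\<leftarrow>xs. poly g x) = (\<Sum>y\<leftarrow>ys. poly g y)"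
  shows "xs = ys"
proof -
  (* If the last point is odd, no even point to its right limits where the sign changes back. *)
  define c where "c k = (if even k then real k
      else if Suc k < L then min (max (ys ! w k) (real k - 1)) (real k + 1)
      else max (ys ! w k) (real k - 1))" for k
  (* The minus sign makes h negative to the left of all breakpoints, where entries can only
     have moved to the left. *)
  define h where "h = - (\<Prod>k<L. [:c k, -1:])"
  have mono: "c k \<le> c (Suc k)" if "Suc k < L" for k
    using that by (auto simp: c_def)
  have poly_h: "poly h t = - (\<Prod>k<L. c k - t)" for t
    by (simp add: h_def poly_prod)
  have poly_h_0: "poly h t = 0" if "t \<in> c ` {..<L}" for t
    unfolding poly_h neg_equal_0_iff_equal by (rule prod_zero) (use that in auto)
  have grid: "\<exists>b<L. xs ! j = real b" if "j < length xs" for j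
    using xs that nth_mem by fastforce
  show ?thesis
  proof (rule eq_if_sign_aligned[OF len sums])
    show "h \<noteq> 0" by (simp add: h_def)
    show "degree h < Suc L" by (simp add: h_def degree_prod_eq_sum_degree)
  next
    fix j t assume j: "j < length xs" and t: "xs ! j < t" "t < ys ! j"
    show "0 \<le> poly h t"
    proof (cases "t \<in> c ` {..<L}")
      case False
      then obtain r where r: "r \<le> L" "0 < r \<Longrightarrow> c (r - 1) < t" "r < L \<Longrightarrow> t < c r"
          "sgn (\<Prod>k<L. c k - t) = (-1) ^ r"
        using sgn_prod_of_sorted[of L c t] mono by blast
      obtain b where b: "b < L" "xs ! j = real b" using grid j by blast
      have "odd r"
      proof
        assume "even r"
        show False
        proof (cases r)
          case 0
          then show ?thesis using r(3) b t \<open>even r\<close> by (simp add: c_def)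
        next
          case (Suc q)
          have q: "odd q" "q < L" using Suc \<open>even r\<close> r(1) by auto
          have cq: "c q < t" using r(2) Suc by simp
          have tr: "t < real q + 1" if "Suc q < L"
            using r(3) that Suc q by (simp add: c_def)
          (* The breakpoint left of t belongs to the odd q, and it is not one clamped to q + 1. *)
          have yq: "ys ! w q < t"
            using cq tr q by (auto simp: c_def split: if_splits)
          have "b \<le> q" using b t tr Suc r(1) q by (cases "Suc q < L") auto
          then have "j \<le> w q" using w(2)[OF q j] b by simp
          then have "ys ! j \<le> ys ! w q"
            using sorted(2) w(1)[OF q] len by (simp add: sorted_nth_mono)
          then show False using yq t by simp
        qed
      qed
      then show ?thesis using r(4) poly_h[of t] by (simp add: sgn_if split: if_splits)
    qed (simp add: poly_h_0)
  next
    fix j t assume j: "j < length xs" and t: "ys ! j < t" "t < xs ! j"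
    show "poly h t \<le> 0"
    proof (cases "t \<in> c ` {..<L}")
      case False
      then obtain r where r: "r \<le> L" "0 < r \<Longrightarrow> c (r - 1) < t" "r < L \<Longrightarrow> t < c r"
          "sgn (\<Prod>k<L. c k - t) = (-1) ^ r"
        using sgn_prod_of_sorted[of L c t] mono by blast
      obtain b where b: "b < L" "xs ! j = real b" using grid j by blast
      have "even r"
      proof (rule ccontr)
        assume "odd r"
        then obtain q where q: "r = Suc q" "even q" by (cases r) auto
        have tq: "real q < t" using r(2) q by (simp add: c_def)
        then have "q < b" using b t by simp
        then have "r < L" "r \<le> b" using q b by auto
        then have "t < c r" using r(3) by simp
        (* The breakpoint right of t belongs to the odd r, and it is not one clamped to r - 1. *)
        then have yr: "t < ys ! w r"
          using tq q \<open>odd r\<close> by (auto simp: c_def split: if_splits)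
        have "w r \<le> j" using w(3)[OF \<open>odd r\<close> \<open>r < L\<close> j] b \<open>r \<le> b\<close> by simp
        then have "ys ! w r \<le> ys ! j"
          using sorted(2) j len by (simp add: sorted_nth_mono)
        then show False using yr t by simp
      qed
      then show ?thesis using r(4) poly_h[of t] by (simp add: sgn_if split: if_splits)
    qed (simp add: poly_h_0)
  qed
qed

section \<open>Slices with a single member\<close>

text \<open>
  Only the multiplicities matter for coverings, so the roots may be placed at
  \<open>0, 1, \<dots>, L - 1\<close>.
\<close>
definition grid_roots :: "(nat \<Rightarrow> nat) \<Rightarrow> nat \<Rightarrow> real list" where
  "grid_roots m L = concat (map (\<lambda>k. replicate (m k) (real k)) [0..<L])"

lemma set_grid_roots: "set (grid_roots m L) = real ` {k. k < L \<and> 0 < m k}"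
  by (auto simp: grid_roots_def)

lemma sorted_grid_roots: "sorted (grid_roots m L)"
proof (induction L)
  case (Suc L)
  have "grid_roots m (Suc L) = grid_roots m L @ replicate (m L) (real L)"
    by (simp add: grid_roots_def)
  then show ?case using Suc by (auto simp: sorted_append set_grid_roots)
qed (simp add: grid_roots_def)

lemma length_grid_roots: "length (grid_roots m L) = (\<Sum>k<L. m k)"
  by (induction L) (simp_all add: grid_roots_def)

lemma prod_grid_roots: "(\<Prod>x\<leftarrow>grid_roots m L. [:-x, 1:]) = (\<Prod>k<L. [:- real k, 1:] ^ m k)"
  by (induction L) (simp_all add: grid_roots_def prod_list_replicate del: mult_pCons_left)

lemma simple_grid_root_index:
  assumes "k < L" "m k = 1"
  shows "\<exists>w < length (grid_roots m L). \<forall>j < length (grid_roots m L).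
    (grid_roots m L ! j \<le> real k \<longrightarrow> j \<le> w) \<and> (real k \<le> grid_roots m L ! j \<longrightarrow> w \<le> j)"
proof -
  define us where "us = grid_roots m k"
  define vs where "vs = concat (map (\<lambda>k. replicate (m k) (real k)) [Suc k..<L])"
  have "[0..<L] = [0..<k] @ k # [Suc k..<L]"
    using assms(1) upt_add_eq_append[of 0 k "L - k"] by (simp add: upt_conv_Cons)
  then have split: "grid_roots m L = us @ real k # vs"
    using assms(2) by (simp add: grid_roots_def us_def vs_def)
  have us: "\<forall>x\<in>set us. x < real k" by (auto simp: us_def set_grid_roots)
  have vs: "\<forall>x\<in>set vs. real k < x" by (auto simp: vs_def)
  have "j \<le> length us" if "(us @ real k # vs) ! j \<le> real k" "j < length (us @ real k # vs)" for j
  proof (rule ccontr)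
    assume "\<not> j \<le> length us"
    then have "(us @ real k # vs) ! j \<in> set vs"
      using that(2) by (auto simp: nth_append nth_Cons split: nat.split)
    then show False using vs that(1) by fastforce
  qed
  moreover have "length us \<le> j" if "real k \<le> (us @ real k # vs) ! j" for j
  proof (rule ccontr)
    assume "\<not> length us \<le> j"
    then have "(us @ real k # vs) ! j \<in> set us" by (simp add: nth_append)
    then show False using us that by fastforce
  qed
  ultimately show ?thesis
    unfolding split by (intro exI[of _ "length us"]) simp
qed

text \<open>
  Since positions are counted from 0, the simple roots required here are those at odd \<open>k\<close>.
\<close>
lemma grid_slice_rigid:
  fixes m :: "nat \<Rightarrow> nat"
  assumes odd: "\<And>k. odd k \<Longrightarrow> k < L \<Longrightarrow> m k = 1"
    and G: "G \<in> hyperbolic_slice (\<Sum>k<L. m k) (Suc L) (\<Prod>k<L. [:- real k, 1:] ^ m k)"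
  shows "G = (\<Prod>k<L. [:- real k, 1:] ^ m k)"
proof -
  let ?xs = "grid_roots m L"
  have "G \<in> hyperbolic_polys (length ?xs)"
    using G by (simp add: hyperbolic_slice_def length_grid_roots)
  then obtain ys where ys: "sorted ys" "length ys = length ?xs" "G = (\<Prod>y\<leftarrow>ys. [:-y, 1:])"
    by (rule hyperbolic_splits_sorted)
  have "\<forall>k\<in>{k. odd k \<and> k < L}. \<exists>w < length ?xs. \<forall>j < length ?xs.
      (?xs ! j \<le> real k \<longrightarrow> j \<le> w) \<and> (real k \<le> ?xs ! j \<longrightarrow> w \<le> j)"
    using odd by (intro ballI simple_grid_root_index) auto
  then obtain w where w: "\<forall>k\<in>{k. odd k \<and> k < L}. w k < length ?xs \<and>
      (\<forall>j < length ?xs. (?xs ! j \<le> real k \<longrightarrow> j \<le> w k) \<and> (real k \<le> ?xs ! j \<longrightarrow> w k \<le> j))"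
    by (rule bchoice[THEN exE])
  have "?xs = ys"
  proof (rule alternating_simple_rigid[where w = w])
    show "(\<Sum>x\<leftarrow>?xs. poly g x) = (\<Sum>y\<leftarrow>ys. poly g y)" if "degree g \<le> Suc L" for g
    proof (rule poly_sums_determined[OF _ _ that])
      show "coeff (\<Prod>x\<leftarrow>?xs. [:1, -x:]) k = coeff (\<Prod>y\<leftarrow>ys. [:1, -y:]) k" if "k \<le> Suc L" for k
        by (rule reflected_coeffs_eq_if_slice[OF refl _ _ that])
          (use ys(2) G[unfolded ys(3)] in \<open>simp_all add: length_grid_roots prod_grid_roots\<close>)
    qed (simp add: ys)
    show "set ?xs \<subseteq> real ` {..<L}" by (auto simp: set_grid_roots)
    show "w k < length ?xs" if "odd k" "k < L" for k
      using bspec[OF w, of k] that by simp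
    show "j \<le> w k" if "odd k" "k < L" "j < length ?xs" "?xs ! j \<le> real k" for k j
      using bspec[OF w, of k] that by simp
    show "w k \<le> j" if "odd k" "k < L" "j < length ?xs" "real k \<le> ?xs ! j" for k j
      using bspec[OF w, of k] that by simp
  qed (use ys in \<open>simp_all add: sorted_grid_roots\<close>)
  then show ?thesis using ys(3) prod_grid_roots[of m L] by simp
qed

lemma root_partition_grid:
  assumes "\<And>k. k < L \<Longrightarrow> 0 < m k"
  shows "root_partition (\<Prod>k<L. [:- real k, 1:] ^ m k) = image_mset m (mset_set {..<L})"
proof -
  let ?F = "\<Prod>k<L. [:- real k, 1:] ^ m k"
  have nz: "?F \<noteq> 0" by simp
  have "order (real k) ?F = m k" if "k < L" for k
  proof -
    have "order (real k) ?F = count (proots ?F) (real k)" using nz by simp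
    also have "proots ?F = (\<Sum>j<L. repeat_mset (m j) {#real j#})"
      by (subst proots_prod) (simp_all add: proots_power)
    also have "count \<dots> (real k) = (\<Sum>j<L. if j = k then m j else 0)"
      by (auto simp: count_sum intro!: sum.cong)
    finally show ?thesis using that by simp
  qed
  moreover have "{x. poly ?F x = 0} = real ` {..<L}"
    using assms by (auto simp: poly_prod poly_power)
  then have "mset_set {x. poly ?F x = 0} = image_mset real (mset_set {..<L})"
    by (simp add: image_mset_mset_set)
  ultimately show ?thesis
    unfolding root_partition_def by (simp only: multiset.map_comp comp_def) (rule image_mset_cong, simp)
qed

lemma covering_covers_grid_partition:
  assumes cov: "vandermonde_covering n (Suc L) P"
    and pos: "\<And>k. k < L \<Longrightarrow> 0 < m k" and odd: "\<And>k. odd k \<Longrightarrow> k < L \<Longrightarrow> m k = 1"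
    and n: "n = (\<Sum>k<L. m k)"
  shows "\<exists>q\<in>P. coarser (image_mset m (mset_set {..<L})) q"
proof -
  let ?F = "\<Prod>k<L. [:- real k, 1:] ^ m k"
  have "?F \<in> hyperbolic_polys n"
    using prod_linear_in_hyperbolic_polys[of "grid_roots m L"]
    by (simp add: prod_grid_roots length_grid_roots n)
  then obtain q G where "q \<in> P" "G \<in> hyperbolic_slice n (Suc L) ?F" "coarser (root_partition G) q"
    using cov by (auto simp: vandermonde_covering_def)
  moreover from this(2) have "G = ?F" using grid_slice_rigid[of L m G, OF odd] n by simp
  ultimately show ?thesis using root_partition_grid[OF pos, of L] by auto
qed

section \<open>Merging two parts\<close>

definition large_parts :: "nat multiset \<Rightarrow> nat multiset" where
  "large_parts q = filter_mset (\<lambda>x. 2 \<le> x) q"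

definition merges :: "nat multiset \<Rightarrow> nat multiset set" where
  "merges q = {p. \<exists>a b r. q = {#a, b#} + r \<and> p = {#a + b#} + r}"

lemma size_le_size_sum_mset:
  "{#} \<notin># M \<Longrightarrow> size M \<le> size (sum_mset M)"
proof (induction M)
  case (add N M)
  then have "1 \<le> size N" by (cases N) auto
  with add show ?case by auto
qed simp

lemma groups_are_singletons:
  "{#} \<notin># M \<Longrightarrow> size (sum_mset M) = size M \<Longrightarrow> image_mset sum_mset M = sum_mset M"
  for M :: "nat multiset multiset"
proof (induction M)
  case (add N M)
  have "1 \<le> size N" using add.prems by (cases N) auto
  moreover have "size M \<le> size (sum_mset M)" using add.prems by (intro size_le_size_sum_mset) auto
  ultimately have "size N = 1" "size (sum_mset M) = size M" using add.prems by auto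
  moreover from this(1) obtain c where "N = {#c#}" by (metis One_nat_def size_1_singleton_mset)
  ultimately show ?case using add by auto
qed simp

text \<open>
  All groups are nonempty, so if there is one group less than there are parts, then one group has two
  parts and all others are singletons.
\<close>
lemma merges_if_coarser:
  assumes "coarser p q" "size q = Suc (size p)"
  shows "p \<in> merges q"
proof -
  have "image_mset sum_mset M \<in> merges (sum_mset M)"
    if "{#} \<notin># M" "size (sum_mset M) = Suc (size M)" for M :: "nat multiset multiset"
    using that
  proof (induction M)
    case (add N M)
    have N: "1 \<le> size N" using add.prems by (cases N) auto
    have M: "size M \<le> size (sum_mset M)" using add.prems by (intro size_le_size_sum_mset) auto
    show ?case
    proof (cases "size N = 1")
      case True
      then obtain c where c: "N = {#c#}" by (metis One_nat_def size_1_singleton_mset)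
      have "image_mset sum_mset M \<in> merges (sum_mset M)"
        using add True by auto
      then obtain a b r where "sum_mset M = {#a, b#} + r" "image_mset sum_mset M = {#a + b#} + r"
        by (auto simp: merges_def)
      then have "sum_mset (add_mset N M) = {#a, b#} + add_mset c r"
        "image_mset sum_mset (add_mset N M) = {#a + b#} + add_mset c r"
        using c by auto
      then show ?thesis unfolding merges_def by blast
    next
      case False
      then have "size N = 2" and sM: "size (sum_mset M) = size M"
        using N M add.prems by auto
      then obtain a b where N: "N = {#a, b#}"
        by (metis One_nat_def Suc_1 size_1_singleton_mset size_eq_Suc_imp_eq_union size_add_mset nat.inject)
      have "image_mset sum_mset M = sum_mset M"
        using groups_are_singletons[OF _ sM] add.prems by auto
      then show ?thesis using N by (auto simp: merges_def)
    qed
  qed simp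
  then show ?thesis using assms by (auto simp: coarser_def)
qed

section \<open>Counting merges by large parts\<close>

lemma merges_two_large:
  assumes "0 \<notin># q" "p \<in> merges q" "Suc (size (large_parts p)) = size (large_parts q)"
  shows "\<exists>a b. {#a, b#} \<subseteq># large_parts q \<and> p = add_mset (a + b) (q - {#a, b#})"
proof -
  obtain a b r where q: "q = {#a, b#} + r" and p: "p = {#a + b#} + r"
    using assms(2) by (auto simp: merges_def)
  have "0 < a" "0 < b" using assms(1) q by auto
  then have "2 \<le> a" "2 \<le> b"
    using assms(3) unfolding q p large_parts_def by (auto split: if_splits)
  then have "{#a, b#} \<subseteq># large_parts q" by (simp add: q large_parts_def)
  moreover have "p = add_mset (a + b) (q - {#a, b#})" by (simp add: q p)
  ultimately show ?thesis by blast
qed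

lemma finite_card_le_image: "finite B \<Longrightarrow> A \<subseteq> f ` B \<Longrightarrow> finite A \<and> card A \<le> card B"
  using card_mono[of "f ` B" A] card_image_le[of B f] finite_subset[of A "f ` B"] by simp

text \<open>
  The merged pair is encoded by a two-element set of positions in a list of the large parts, so that
  repeated parts need no special treatment.
\<close>
lemma card_merges_two_large:
  assumes "0 \<notin># q" "size (large_parts q) = Suc i"
  shows "finite {p \<in> merges q. size (large_parts p) = i} \<and>
    card {p \<in> merges q. size (large_parts p) = i} \<le> Suc i choose 2"
proof -
  obtain l where l: "mset l = large_parts q" using ex_mset by blast
  then have len: "length l = Suc i" using assms(2) size_mset[of l] by simp
  let ?S = "{A. A \<subseteq> {..<Suc i} \<and> card A = 2}"
  let ?f = "\<lambda>A. add_mset (sum ((!) l) A) (q - image_mset ((!) l) (mset_set A))"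
  have "{p \<in> merges q. size (large_parts p) = i} \<subseteq> ?f ` ?S"
  proof
    fix p assume "p \<in> {p \<in> merges q. size (large_parts p) = i}"
    then obtain a b where ab: "{#a, b#} \<subseteq># mset l" and p: "p = add_mset (a + b) (q - {#a, b#})"
      using merges_two_large[of q p] assms l by auto
    then have a: "a \<in> set l" and b: "b \<in># mset l - {#a#}"
      by (auto simp: insert_subset_eq_iff)
    obtain us vs where us: "l = us @ a # vs" using a by (meson split_list)
    have b': "b \<in> set (us @ vs)" using b by (auto simp: us)
    then obtain k where k: "k < length l" "k \<noteq> length us" "l ! k = b"
    proof -
      assume k: "\<And>k. k < length l \<Longrightarrow> k \<noteq> length us \<Longrightarrow> l ! k = b \<Longrightarrow> thesis"
      from b' obtain j where j: "j < length (us @ vs)" "(us @ vs) ! j = b" by (meson in_set_conv_nth)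
      show thesis
      proof (cases "j < length us")
        case True
        then show ?thesis using j k[of j] by (simp add: us nth_append)
      next
        case False
        then show ?thesis using j k[of "Suc j"] by (simp add: us nth_append Suc_diff_le)
      qed
    qed
    have "{length us, k} \<in> ?S" using k len us by auto
    moreover have "p = ?f {length us, k}"
      using p k us by (auto simp: add_mset_commute)
    ultimately show "p \<in> ?f ` ?S" by blast
  qed
  moreover have "finite ?S" by (rule finite_subset[of _ "Pow {..<Suc i}"]) auto
  moreover have "card ?S = Suc i choose 2"
    using n_subsets[OF finite_lessThan, of "Suc i" 2] by (simp only: card_lessThan)
  ultimately show ?thesis using finite_card_le_image[of ?S _ ?f] by (simp only: simp_thms)
qed

lemma card_set_mset_le_size: "card (set_mset M) \<le> size M"
proof (induction M)
  case (add x M)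
  then show ?case by (cases "x \<in># M") (simp_all add: insert_absorb)
qed simp

text \<open>
  Merging two large parts loses one of them and merging two ones creates a new one; so a large part
  must have been merged with a 1.
\<close>
lemma card_merges_one_large:
  assumes "0 \<notin># q" "size (large_parts q) = i"
  shows "finite {p \<in> merges q. size (large_parts p) = i} \<and>
    card {p \<in> merges q. size (large_parts p) = i} \<le> i"
proof -
  have "{p \<in> merges q. size (large_parts p) = i} \<subseteq>
      (\<lambda>a. add_mset (a + 1) (q - {#a, 1#})) ` set_mset (large_parts q)"
  proof
    fix p assume "p \<in> {p \<in> merges q. size (large_parts p) = i}"
    then obtain a b r where q: "q = {#a, b#} + r" and p: "p = {#a + b#} + r"
        and sz: "size (large_parts p) = size (large_parts q)"
      using assms(2) by (auto simp: merges_def)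
    have "0 < a" "0 < b" using assms(1) q by auto
    then have "2 \<le> a \<and> b = 1 \<or> 2 \<le> b \<and> a = 1"
      using sz unfolding q p large_parts_def by (auto split: if_splits)
    then show "p \<in> (\<lambda>a. add_mset (a + 1) (q - {#a, 1#})) ` set_mset (large_parts q)"
    proof
      assume "2 \<le> a \<and> b = 1"
      then show ?thesis by (intro image_eqI[of _ _ a]) (auto simp: p q large_parts_def)
    next
      assume "2 \<le> b \<and> a = 1"
      then show ?thesis by (intro image_eqI[of _ _ b]) (auto simp: p q large_parts_def add_mset_commute)
    qed
  qed
  moreover have "card (set_mset (large_parts q)) \<le> i"
    using assms(2) card_set_mset_le_size[of "large_parts q"] by simp
  ultimately show ?thesis using finite_card_le_image[OF finite_set_mset] by (meson le_trans)
qed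

lemma card_merges_no_large:
  assumes "0 \<notin># q" "Suc (size (large_parts q)) = i"
  shows "finite {p \<in> merges q. size (large_parts p) = i} \<and>
    card {p \<in> merges q. size (large_parts p) = i} \<le> 1"
proof -
  have "{p \<in> merges q. size (large_parts p) = i} \<subseteq> (\<lambda>_. add_mset 2 (q - {#1, 1#})) ` {()}"
  proof
    fix p assume "p \<in> {p \<in> merges q. size (large_parts p) = i}"
    then obtain a b r where q: "q = {#a, b#} + r" and p: "p = {#a + b#} + r"
        and sz: "size (large_parts p) = Suc (size (large_parts q))"
      using assms(2) by (auto simp: merges_def)
    have "0 < a" "0 < b" using assms(1) q by auto
    then have "a = 1 \<and> b = 1"
      using sz unfolding q p large_parts_def by (auto split: if_splits)
    then show "p \<in> (\<lambda>_. add_mset 2 (q - {#1, 1#})) ` {()}"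
      by (auto simp: p q)
  qed
  from finite_card_le_image[OF _ this] show ?thesis by simp
qed

lemma merges_large_cases:
  assumes "0 \<notin># q" "p \<in> merges q"
  shows "size (large_parts q) \<in> {size (large_parts p) - 1..Suc (size (large_parts p))}"
proof -
  obtain a b r where q: "q = {#a, b#} + r" and p: "p = {#a + b#} + r"
    using assms(2) by (auto simp: merges_def)
  have "0 < a" "0 < b" using assms(1) q by auto
  then show ?thesis unfolding q p large_parts_def by auto
qed

lemma card_merges_le:
  assumes "0 \<notin># q" "1 \<le> i"
  shows "finite {p \<in> merges q. size (large_parts p) = i} \<and>
    card {p \<in> merges q. size (large_parts p) = i} \<le>
      (Suc i choose 2) * of_bool (size (large_parts q) = Suc i) +
      i * of_bool (size (large_parts q) = i) + of_bool (Suc (size (large_parts q)) = i)"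
proof -
  consider "size (large_parts q) = Suc i" | "size (large_parts q) = i" | "Suc (size (large_parts q)) = i"
    | "{p \<in> merges q. size (large_parts p) = i} = {}"
    using merges_large_cases[OF assms(1)] assms(2) by fastforce
  then show ?thesis
  proof cases
    case 1
    then show ?thesis using card_merges_two_large[OF assms(1)] by simp
  next
    case 2
    then show ?thesis using card_merges_one_large[OF assms(1)] by simp
  next
    case 3
    then show ?thesis using card_merges_no_large[OF assms(1) 3] by simp
  next
    case 4
    then show ?thesis by (simp only: finite.emptyI card.empty le0 simp_thms)
  qed
qed

lemma finite_partitions: "finite (partitions m r)"
proof (rule finite_subset)
  show "partitions m r \<subseteq> mset ` {xs. set xs \<subseteq> {..m} \<and> length xs = r}"
  proof
    fix p assume p: "p \<in> partitions m r"
    obtain xs where xs: "mset xs = p" using ex_mset by blast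
    have "x \<le> m" if x: "x \<in># p" for x
    proof -
      obtain p' where p': "p = add_mset x p'" using multi_member_split[OF x] by blast
      have "sum_mset p = m" using p by (simp add: partitions_def)
      then show ?thesis by (simp add: p')
    qed
    then show "p \<in> mset ` {xs. set xs \<subseteq> {..m} \<and> length xs = r}"
      using xs p by (intro image_eqI[of _ _ xs]) (auto simp: partitions_def)
  qed
  show "finite (mset ` {xs. set xs \<subseteq> {..m} \<and> length xs = r})"
    using finite_lists_length_eq[of "{..m}" r] by simp
qed

text \<open>
  Passing from \<open>p\<close> to \<open>image_mset Suc p\<close> turns all parts of \<open>p\<close> into large ones. Hence the number of
  large parts of the padded partition is \<open>i\<close>, and \<open>p\<close> can be recovered from it.
\<close>
lemma card_partitions_le:
  assumes P: "finite P" "\<And>q. q \<in> P \<Longrightarrow> 0 \<notin># q" and "1 \<le> i"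
    and cover: "\<And>p. p \<in> partitions m i \<Longrightarrow>
      \<exists>q\<in>P. image_mset Suc p + replicate_mset l 1 \<in> merges q"
  shows "card (partitions m i) \<le>
    (Suc i choose 2) * card {q \<in> P. size (large_parts q) = Suc i} +
    i * card {q \<in> P. size (large_parts q) = i} + card {q \<in> P. Suc (size (large_parts q)) = i}"
proof -
  let ?f = "\<lambda>p. image_mset Suc p + replicate_mset l (1::nat)"
  let ?D = "\<lambda>q. {p \<in> merges q. size (large_parts p) = i}"
  have "inj_on ?f (partitions m i)"
  proof (rule inj_onI)
    fix p p' assume "?f p = ?f p'"
    then have "image_mset (\<lambda>x. x - 1) (image_mset Suc p) = image_mset (\<lambda>x. x - 1) (image_mset Suc p')"
      by simp
    then show "p = p'" by (simp add: multiset.map_comp comp_def)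
  qed
  then have "card (partitions m i) = card (?f ` partitions m i)" by (simp add: card_image)
  also have "\<dots> \<le> card (\<Union>q\<in>P. ?D q)"
  proof (rule card_mono)
    show "finite (\<Union>q\<in>P. ?D q)" using card_merges_le P \<open>1 \<le> i\<close> by blast
    show "?f ` partitions m i \<subseteq> (\<Union>q\<in>P. ?D q)"
    proof (rule image_subsetI)
      fix p assume p: "p \<in> partitions m i"
      have "large_parts (?f p) = image_mset Suc p"
      proof -
        have "filter_mset (\<lambda>x. 2 \<le> x) (image_mset Suc p) = image_mset Suc p"
          using p by (auto simp: partitions_def filter_mset_eq_conv Suc_le_eq numeral_2_eq_2 intro!: gr0I)
        then show ?thesis by (simp add: large_parts_def)
      qed
      then have "size (large_parts (?f p)) = i" using p by (simp add: partitions_def)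
      then show "?f p \<in> (\<Union>q\<in>P. ?D q)" using cover[OF p] by blast
    qed
  qed
  also have "\<dots> \<le> (\<Sum>q\<in>P. card (?D q))" by (rule card_UN_le[OF P(1)])
  also have "\<dots> \<le> (\<Sum>q\<in>P. (Suc i choose 2) * of_bool (size (large_parts q) = Suc i) +
      i * of_bool (size (large_parts q) = i) + of_bool (Suc (size (large_parts q)) = i))"
    by (rule sum_mono) (use card_merges_le P(2) \<open>1 \<le> i\<close> in blast)
  also have "\<dots> = (Suc i choose 2) * card {q \<in> P. size (large_parts q) = Suc i} +
    i * card {q \<in> P. size (large_parts q) = i} + card {q \<in> P. Suc (size (large_parts q)) = i}"
    using P(1) by (simp add: sum.distrib sum_distrib_left[symmetric] sum_of_bool_eq Int_def conj_commute)
  finally show ?thesis .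
qed

section \<open>The recursion for the lower bound\<close>

lemma B_seq_0: "B_seq m 0 = 0"
  by (subst B_seq.simps) simp

lemma B_seq_1: "B_seq m (Suc 0) = 1"
  by (subst B_seq.simps) simp

text \<open>
  For \<open>i \<ge> 2\<close>, with \<open>C = Suc i choose 2\<close> and partial sums \<open>S r = N 0 + \<dots> + N r\<close> the hypothesis reads
  \<open>card (partitions m i) \<le> C * S (i + 1) - (C - i) * S i - (i - 1) * S (i - 1) - S (i - 2)\<close>.
  As \<open>C - i\<close> and \<open>i - 1\<close> are nonnegative, \<open>S i\<close>, \<open>S (i - 1)\<close> and \<open>S (i - 2)\<close> may be replaced by the
  smaller partial sums of \<open>B_seq m\<close>. A comparison of \<open>N (Suc i)\<close> with \<open>B_seq m i\<close> alone would fail,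
  since a large value of \<open>N i\<close> makes room for a small value of \<open>N (Suc i)\<close>.
\<close>
lemma sum_B_seq_le:
  fixes N :: "nat \<Rightarrow> nat"
  assumes cov: "\<And>i. 1 \<le> i \<Longrightarrow> i \<le> h \<Longrightarrow>
    card (partitions m i) \<le> (Suc i choose 2) * N (Suc i) + i * N i + N (i - 1)"
    and "1 \<le> m"
  shows "i \<le> h \<Longrightarrow> (\<Sum>j = 0..i. B_seq m j) \<le> int (\<Sum>r\<le>Suc i. N r)"
proof (induction i rule: less_induct)
  case (less i)
  show ?case
  proof (cases "i \<le> 1")
    case True
    have "{#m#} \<in> partitions m 1" using \<open>1 \<le> m\<close> by (simp add: partitions_def)
    then have "1 \<le> card (partitions m 1)"
      using card_gt_0_iff[of "partitions m 1"] finite_partitions[of m 1] by auto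
    moreover have "i = 0 \<or> i = 1" using True by auto
    moreover have "(Suc 1 choose 2) * N (Suc 1) + 1 * N 1 + N (1 - 1) = N (Suc (Suc 0)) + N (Suc 0) + N 0"
      by (simp only: Suc_1 binomial_n_n) (simp add: numeral_2_eq_2)
    ultimately have "i = 0 \<or> i = 1 \<and> 1 \<le> N (Suc (Suc 0)) + N (Suc 0) + N 0"
      using cov[of 1] less.prems by linarith
    then show ?thesis by (auto simp: B_seq_0 B_seq_1)
  next
    case False
    have "i = Suc (Suc (i - 2))" using False by simp
    then obtain k where k: "i = Suc (Suc k)" ..
    define S where "S r = real (\<Sum>j\<le>r. N j)" for r
    define T where "T r = real_of_int (\<Sum>j = 0..r. B_seq m j)" for r
    define C where "C = ((real i)\<^sup>2 + real i) / 2"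
    define M where "M = real (card (partitions m i))"
    have C: "real (Suc i choose 2) = C"
    proof -
      have "2 * (Suc i choose 2) = Suc i * i" by (simp add: choose_two)
      then have "real (2 * (Suc i choose 2)) = real (Suc i * i)" by (rule arg_cong)
      then have "2 * real (Suc i choose 2) = (real i + 1) * real i"
        unfolding of_nat_mult by (simp only: of_nat_numeral of_nat_Suc add.commute)
      then show ?thesis unfolding C_def by (simp add: power2_eq_square distrib_right)
    qed
    have C_ge: "real i \<le> C" "0 < C"
    proof -
      have "real i * 1 \<le> real i * real i" using False by (intro mult_left_mono) auto
      moreover have "0 < real i" using False by simp
      ultimately show "real i \<le> C" "0 < C" by (simp_all add: C_def power2_eq_square add_pos_pos)
    qed
    have N: "real (N (Suc r)) = S (Suc r) - S r" for r by (simp add: S_def)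
    have B: "real_of_int (B_seq m (Suc r)) = T (Suc r) - T r" for r by (simp add: T_def)
    have IH: "T r \<le> S (Suc r)" if "r < i" for r
    proof -
      have "(\<Sum>j = 0..r. B_seq m j) \<le> int (\<Sum>j\<le>Suc r. N j)"
        using less.IH[OF that] less.prems that by simp
      then have "real_of_int (\<Sum>j = 0..r. B_seq m j) \<le> real_of_int (int (\<Sum>j\<le>Suc r. N j))"
        by (simp only: of_int_le_iff)
      then show ?thesis by (simp only: T_def S_def of_int_of_nat_eq)
    qed
    have "M \<le> real ((Suc i choose 2) * N (Suc i) + i * N i + N (i - 1))"
      unfolding M_def of_nat_le_iff by (rule cov) (use False less.prems in auto)
    then have cov': "M \<le> C * (S (Suc i) - S i) + real i * (S i - S (Suc k)) + (S (Suc k) - S k)"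
      using N[of i] N[of "Suc k"] N[of k] unfolding of_nat_add of_nat_mult C by (simp add: k)
    (* The partial sum before T k; it is 0 for k = 0. *)
    define Tk where "Tk = T k - real_of_int (B_seq m k)"
    have Tk: "Tk \<le> S k"
    proof (cases k)
      case 0
      then show ?thesis by (simp add: Tk_def T_def S_def)
    next
      case (Suc k')
      then show ?thesis using IH[of k'] k B[of k'] by (simp add: Tk_def)
    qed
    define X where "X = M - real i * of_int (B_seq m (Suc k)) - of_int (B_seq m k)"
    have "X / C \<le> S (Suc i) - T (Suc k)"
    proof -
      have "X = M - real i * (T (Suc k) - T k) - (T k - Tk)"
        by (simp add: X_def B Tk_def)
      moreover have "(C - real i) * T (Suc k) \<le> (C - real i) * S i"
        using IH[of "Suc k"] k C_ge by (intro mult_left_mono) auto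
      moreover have "(real i - 1) * T k \<le> (real i - 1) * S (Suc k)"
        using IH[of k] k by (intro mult_left_mono) auto
      ultimately have "X \<le> C * (S (Suc i) - T (Suc k))"
        using cov' Tk by (simp add: algebra_simps)
      then show ?thesis using C_ge by (simp add: divide_le_eq mult.commute)
    qed
    (* The right-hand side is an integer, so the ceiling of the left-hand side obeys the same bound. *)
    also have "S (Suc i) - T (Suc k) = of_int (int (\<Sum>j\<le>Suc i. N j) - (\<Sum>j = 0..Suc k. B_seq m j))"
      by (simp add: S_def T_def)
    finally have "\<lceil>X / C\<rceil> \<le> int (\<Sum>j\<le>Suc i. N j) - (\<Sum>j = 0..Suc k. B_seq m j)"
      by (simp only: ceiling_le_iff)
    moreover have "B_seq m i = \<lceil>X / C\<rceil>"
      by (subst B_seq.simps) (simp add: k X_def C_def M_def mult.commute right_diff_distrib mult.left_commute)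
    moreover have "(\<Sum>j = 0..i. B_seq m j) = (\<Sum>j = 0..Suc k. B_seq m j) + B_seq m i"
      by (simp add: k)
    ultimately show ?thesis by linarith
  qed
qed

section \<open>Coverings\<close>

lemma mset_conv_nth: "mset l = image_mset ((!) l) (mset_set {..<length l})"
  by (metis atLeast0LessThan map_nth mset_map mset_upt)

lemma sum_mset_image_Suc: "sum_mset (image_mset Suc p) = sum_mset p + size p"
  by (induction p) simp_all

text \<open>
  The increased parts of \<open>p\<close> are used as multiplicities at the points \<open>0, 2, \<dots>, 2 * i - 2\<close>, and
  all other multiplicities are 1. These points fit into \<open>{..<s - 1}\<close> because of \<open>2 * i \<le> s\<close>.
\<close>
lemma covering_merges:
  assumes cov: "vandermonde_covering n s P" and "1 \<le> s" "s \<le> n" "2 * i \<le> s"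
    and p: "p \<in> partitions (n - s + 1) i"
  shows "\<exists>q\<in>P. image_mset Suc p + replicate_mset (s - 1 - i) 1 \<in> merges q"
proof -
  define L where "L = s - 1"
  have s: "s = Suc L" using \<open>1 \<le> s\<close> by (simp add: L_def)
  obtain l where l: "mset l = p" using ex_mset by blast
  have len: "length l = i" using p l by (auto simp: partitions_def)
  define m where "m k = (if even k \<and> k div 2 < i then Suc (l ! (k div 2)) else 1)" for k
  let ?E = "(\<lambda>j. 2 * j) ` {..<i}"
  have E: "?E \<subseteq> {..<L}" using \<open>2 * i \<le> s\<close> s by auto
  have card_E: "card ?E = i" by (simp add: card_image inj_on_def)
  have "image_mset m (mset_set ?E) = image_mset (\<lambda>j. Suc (l ! j)) (mset_set {..<i})"
    by (simp add: image_mset_mset_set[symmetric] inj_on_def multiset.map_comp comp_def)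
      (rule image_mset_cong, simp add: m_def)
  also have "\<dots> = image_mset Suc p"
  proof -
    have "p = image_mset ((!) l) (mset_set {..<i})"
      using l mset_conv_nth[of l] len by simp
    then show ?thesis by (simp add: multiset.map_comp comp_def)
  qed
  finally have on_E: "image_mset m (mset_set ?E) = image_mset Suc p" .
  have "image_mset m (mset_set ({..<L} - ?E)) = image_mset (\<lambda>_. 1) (mset_set ({..<L} - ?E))"
  proof (rule image_mset_cong)
    fix k assume "k \<in># mset_set ({..<L} - ?E)"
    then have "k \<notin> ?E" by simp
    then show "m k = 1" by (auto simp: m_def elim!: evenE)
  qed
  also have "\<dots> = replicate_mset (L - i) 1"
    using E card_E by (simp add: image_mset_const_eq card_Diff_subset finite_subset)
  finally have off_E: "image_mset m (mset_set ({..<L} - ?E)) = replicate_mset (L - i) 1" .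
  have "mset_set {..<L} = mset_set ?E + mset_set ({..<L} - ?E)"
    using E by (subst mset_set_Union[symmetric]) (auto simp: Un_absorb1)
  then have m: "image_mset m (mset_set {..<L}) = image_mset Suc p + replicate_mset (L - i) 1"
    using on_E off_E by simp
  have "i \<le> L" using card_mono[OF finite_lessThan E] card_E by simp
  have sum_m: "(\<Sum>k<L. m k) = n"
  proof -
    have "(\<Sum>k<L. m k) = sum_mset (image_mset m (mset_set {..<L}))"
      by (simp add: sum_unfold_sum_mset)
    also have "\<dots> = (n - s + 1 + i) + (L - i)"
      using p by (simp add: m sum_mset_image_Suc partitions_def)
    finally show ?thesis using \<open>i \<le> L\<close> \<open>s \<le> n\<close> s by simp
  qed
  have "\<exists>q\<in>P. coarser (image_mset m (mset_set {..<L})) q"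
    using cov unfolding s
    by (rule covering_covers_grid_partition) (simp add: m_def, simp add: m_def, rule sum_m[symmetric])
  then obtain q where q: "q \<in> P" "coarser (image_mset Suc p + replicate_mset (L - i) 1) q"
    unfolding m by blast
  have "size q = s" using q(1) cov by (auto simp: vandermonde_covering_def partitions_def)
  moreover have "size (image_mset Suc p + replicate_mset (L - i) 1) = L"
    using p \<open>i \<le> L\<close> by (simp add: partitions_def)
  ultimately have "image_mset Suc p + replicate_mset (L - i) 1 \<in> merges q"
    using q(2) s by (intro merges_if_coarser) simp_all
  then show ?thesis using q(1) by (auto simp: L_def)
qed

theorem theorem4p8:
  fixes n s :: nat and P :: "nat multiset set"
  assumes "1 \<le> s" and "s \<le> n"
    and "vandermonde_covering n s P"
  shows "int (card P) \<ge> (\<Sum>i = 0..s div 2. B_seq (n - s + 1) i)"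
proof -
  define N where "N r = card {q \<in> P. size (large_parts q) = r}" for r
  have P: "P \<subseteq> partitions n s" using assms(3) by (simp add: vandermonde_covering_def)
  then have fin: "finite P" using finite_partitions finite_subset by blast
  have pos: "0 \<notin># q" if "q \<in> P" for q using P that by (auto simp: partitions_def)
  have "(\<Sum>i = 0..s div 2. B_seq (n - s + 1) i) \<le> int (\<Sum>r\<le>Suc (s div 2). N r)"
  proof (rule sum_B_seq_le[OF _ _ order_refl])
    fix i assume i: "1 \<le> i" "i \<le> s div 2"
    have "card (partitions (n - s + 1) i) \<le>
        (Suc i choose 2) * card {q \<in> P. size (large_parts q) = Suc i} +
        i * card {q \<in> P. size (large_parts q) = i} +
        card {q \<in> P. Suc (size (large_parts q)) = i}"
      by (rule card_partitions_le[OF fin pos i(1) covering_merges[OF assms(3,1,2)]])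
        (use i in auto)
    moreover have "{q \<in> P. Suc (size (large_parts q)) = i} = {q \<in> P. size (large_parts q) = i - 1}"
      using i by auto
    ultimately show "card (partitions (n - s + 1) i) \<le>
        (Suc i choose 2) * N (Suc i) + i * N i + N (i - 1)"
      by (simp only: N_def)
  qed simp
  also have "(\<Sum>r\<le>Suc (s div 2). N r) =
      card (\<Union>r\<le>Suc (s div 2). {q \<in> P. size (large_parts q) = r})"
    unfolding N_def by (rule card_UN_disjoint[symmetric]) (use fin in auto)
  also have "\<dots> \<le> card P" by (rule card_mono[OF fin]) auto
  finally show ?thesis by simp
qed

end
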